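(* Fix $\beta\in(0,1)$ and choose $\beta_i\in(0,1)$, $i\in\mathcal N$, such that $\sum_{i\in\mathcal N}\beta_i=\beta$. For each $i\in\mathcal N$ let $\epsilon_i:\{0,1,\dots,K_i\}\to[0,1]$ satisfy $$\epsilon_i(K_i)=1,\qquad \sum_{k=0}^{K_i-1}\binom{K_i}{k}\bigl(1-\epsilon_i(k)\bigr)^{K_i-k}=\beta_i ,$$ and let $$\epsilon^\ast=\max\Bigl\{\sum_{i\in\mathcal N}\epsilon_i(s_i)\ :\ \sum_{i\in\mathcal N}s_i\le M,\ s_i\in\{0,1,\dots,K_i\}\Bigr\},\qquad M=2^N-1 .$$ Then $$\mathbb P^K\bigl\{\boldsymbol\xi\in\Xi^K:\ \mathbb V(C(G_K))\le\epsilon^\ast\bigr\}\ \ge\ 1-\beta .$$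
   Context: Setting. $\mathcal N=\{1,\dots,N\}$ is the set of agents. $\Xi$ is the uncertainty set, endowed with an (unknown) probability measure $\mathbb P$. For every nonempty coalition $S\subset\mathcal N$ (throughout, $\subset$ denotes proper inclusion, so $S\neq\mathcal N$) there is a value function $u_S:\Xi\to\mathbb R$; the value of the grand coalition is a deterministic number $u_{\mathcal N}\in\mathbb R$. An allocation is a vector $\boldsymbol x=(x_i)_{i\in\mathcal N}\in\mathbb R^N$. Private sampling. Each agent $i$ draws $\boldsymbol\xi_i=(\xi_i^{(1)},\dots,\xi_i^{(K_i)})\in\Xi^{K_i}$, consisting of $K_i$ independent samples from $\mathbb P$; samples of different agents are independent. Put $K=\sum_{i\in\mathcal N}K_i$; $\boldsymbol\xi=(\boldsymbol\xi_i)_{i\in\mathcal N}$ has law $\mathbb P^K$ (the $K$-fold product measure) on $\Xi^K$. Scenario core with private sampling: $$C(G_K)=\Bigl\{\boldsymbol x\in\mathbb R^N:\ \sum_{i\in\mathcal N}x_i=u_{\mathcal N}\ \text{ and }\ \sum_{i\in S}x_i\ge\max_{i\in S}\max_{k=1,\dots,K_i}u_S(\xi_i^{(k)})\ \ \forall S\subset\mathcal N\Bigr\}.$$ Standing assumption: $C(G_K)$ is nonempty for every $\boldsymbol\xi\in\Xi^K$. Probability of core instability: $\mathbb V(C(G_K))=\mathbb P\{\xi\in\Xi:\ \exists\,\boldsymbol x\in C(G_K),\ \exists\,S\subset\mathcal N:\ \sum_{i\in S}x_i<u_S(\xi)\}$. *)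

theory Defs
  imports "HOL-Probability.Probability"
begin

text \<open>
  Agents are the elements of a finite type, so N is CARD('n), coalitions are
  values of type 'n set, the grand coalition is UNIV, and allocations are vectors
  in real ^ 'n.  The uncertainty set is the space of the probability measure P.
\<close>

definition proper_coalition :: "'n set \<Rightarrow> bool" where
  "proper_coalition S \<longleftrightarrow> S \<noteq> {} \<and> S \<noteq> UNIV"

text \<open>
  The \<open>k\<close>-th sample of agent \<open>i\<close> is \<open>\<xi> (i, k)\<close>, so the index set has
  \<open>\<Sum>i\<in>UNIV. K i\<close> elements.
\<close>

definition sample_measure :: "'a measure \<Rightarrow> ('n::finite \<Rightarrow> nat) \<Rightarrow> ('n \<times> nat \<Rightarrow> 'a) measure" where
  "sample_measure P K = PiM (SIGMA i:UNIV. {1..K i}) (\<lambda>_. P)"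

text \<open>The inner maximum is meaningful only if every \<open>K i\<close> is positive.\<close>

definition scenario_core ::
    "('n::finite set \<Rightarrow> 'a \<Rightarrow> real) \<Rightarrow> real \<Rightarrow> ('n \<Rightarrow> nat) \<Rightarrow> ('n \<times> nat \<Rightarrow> 'a) \<Rightarrow> (real ^ 'n) set" where
  "scenario_core u uN K \<xi> =
    {x. (\<Sum>i\<in>UNIV. x $ i) = uN \<and>
        (\<forall>S. proper_coalition S \<longrightarrow>
           (\<Sum>i\<in>S. x $ i) \<ge> (MAX i\<in>S. MAX k\<in>{1..K i}. u S (\<xi> (i, k))))}"

text \<open>
  For measurable value functions the event below is measurable for every set \<open>C\<close>:
  for each coalition the values of \<open>u S \<zeta>\<close> that exceed some coalition payoff
  form an upward closed set of reals.
\<close>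

definition core_instability ::
    "'a measure \<Rightarrow> ('n::finite set \<Rightarrow> 'a \<Rightarrow> real) \<Rightarrow> (real ^ 'n) set \<Rightarrow> real" where
  "core_instability P u C =
    measure P {\<zeta> \<in> space P. \<exists>x\<in>C. \<exists>S. proper_coalition S \<and> (\<Sum>i\<in>S. x $ i) < u S \<zeta>}"

definition eps_star :: "('n::finite \<Rightarrow> nat) \<Rightarrow> nat \<Rightarrow> ('n \<Rightarrow> nat \<Rightarrow> real) \<Rightarrow> real" where
  "eps_star K M \<epsilon> =
    Max {\<Sum>i\<in>UNIV. \<epsilon> i (s i) | s. (\<Sum>i\<in>UNIV. s i) \<le> M \<and> (\<forall>i. s i \<in> {0..K i})}"

end

theory Submission
  imports Defs
begin

text \<open>
  For every proper coalition S choose one sample attaining the maximum that bounds the payoff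
  of S; this support has at most \<open>2 ^ N - 2\<close> elements. An unstable scenario exceeds the
  bound of some coalition S, so it is charged to an agent \<open>i \<in> S\<close>. Discard the samples
  of agent i outside the support: none of them exceeds the remaining bounds of a coalition
  containing i, and given the remaining samples the discarded ones are independent. If the
  instability charged to i has probability above \<open>\<epsilon> i k\<close>, where k samples of agent i are
  kept, this happens with probability at most \<open>(1 - \<epsilon> i k) ^ (K i - k)\<close>. A union bound over
  the kept subset and over the agents yields the total \<open>\<beta>\<close>.
\<close>

section \<open>Independent samples that all avoid a set of large probability\<close>

text \<open>Given the coordinates in \<open>A\<close>, those in \<open>B\<close> are still
  independent with law \<open>P\<close>, and each misses the slice of \<open>Q\<close> with
  probability below \<open>1 - e\<close> whenever that slice has mass above \<open>e\<close>.
  Integrating over the \<open>A\<close>-coordinates keeps the bound, although the avoided slice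
  itself depends on them.\<close>

lemma prob_avoid_le:
  fixes P :: "'a measure" and e :: real
  assumes P: "prob_space P" and fin: "finite A" "finite B" and disj: "A \<inter> B = {}"
    and Q: "Q \<in> sets (PiM A (\<lambda>_. P) \<Otimes>\<^sub>M P)" and e: "e \<le> 1"
  defines "E \<equiv> {\<omega> \<in> space (PiM (A \<union> B) (\<lambda>_. P)).
      (\<forall>b\<in>B. (restrict \<omega> A, \<omega> b) \<notin> Q) \<and> e < measure P (Pair (restrict \<omega> A) -` Q)}"
  shows "E \<in> sets (PiM (A \<union> B) (\<lambda>_. P))"
    and "measure (PiM (A \<union> B) (\<lambda>_. P)) E \<le> (1 - e) ^ card B"
proof -
  interpret P: prob_space P by fact
  interpret PP: product_prob_space "\<lambda>_. P" UNIV by unfold_locales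
  interpret AB: prob_space "PiM (A \<union> B) (\<lambda>_. P)" by (rule prob_space_PiM) (rule P)
  interpret A: prob_space "PiM A (\<lambda>_. P)" by (rule prob_space_PiM) (rule P)
  have meas [measurable]: "(\<lambda>x. measure P (Pair x -` Q)) \<in> borel_measurable (PiM A (\<lambda>_. P))"
    unfolding measure_def using P.measurable_emeasure_Pair[OF Q] by simp
  have [measurable]: "(\<lambda>\<omega>. restrict \<omega> A) \<in> measurable (PiM (A \<union> B) (\<lambda>_. P)) (PiM A (\<lambda>_. P))"
    by (rule measurable_restrict_subset) auto
  have [measurable]: "Measurable.pred (PiM A (\<lambda>_. P) \<Otimes>\<^sub>M P) (\<lambda>p. p \<in> Q)"
    using Q by simp
  show E: "E \<in> sets (PiM (A \<union> B) (\<lambda>_. P))"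
    unfolding E_def using fin by measurable
  have inner: "(\<integral>\<^sup>+ y. indicator E (merge A B (x, y)) \<partial>PiM B (\<lambda>_. P)) \<le> ennreal ((1 - e) ^ card B)"
    if x: "x \<in> space (PiM A (\<lambda>_. P))" for x
  proof (cases "e < measure P (Pair x -` Q)")
    case False
    have "indicator E (merge A B (x, y)) = (0::ennreal)" for y
      using False x disj by (auto simp: E_def indicator_def space_PiM PiE_def extensional_restrict)
    then show ?thesis by simp
  next
    case True
    have Qx: "Pair x -` Q \<in> sets P" by (rule sets_Pair1) (rule Q)
    \<comment> \<open>The fibre of \<open>E\<close> over \<open>x\<close> lies in this box, whose
      measure is a product of equal factors.\<close>
    define C where "C = PiE B (\<lambda>_. space P - Pair x -` Q)"
    have C: "C \<in> sets (PiM B (\<lambda>_. P))"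
      unfolding C_def using fin Qx by (intro sets_PiM_I_finite) auto
    have "(\<integral>\<^sup>+ y. indicator E (merge A B (x, y)) \<partial>PiM B (\<lambda>_. P))
        \<le> (\<integral>\<^sup>+ y. indicator C y \<partial>PiM B (\<lambda>_. P))"
    proof (rule nn_integral_mono)
      fix y assume y: "y \<in> space (PiM B (\<lambda>_. P))"
      have "y \<in> C" if *: "merge A B (x, y) \<in> E"
      proof -
        have "y b \<in> space P - Pair x -` Q" if b: "b \<in> B" for b
        proof -
          have "(restrict (merge A B (x, y)) A, merge A B (x, y) b) \<notin> Q"
            using * b by (auto simp: E_def)
          moreover have "merge A B (x, y) b = y b" using b disj by (auto simp: merge_def)
          moreover have "restrict (merge A B (x, y)) A = x"
            using x disj by (auto simp: space_PiM PiE_def extensional_restrict)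
          ultimately show ?thesis using y b by (auto simp: space_PiM PiE_def)
        qed
        then show ?thesis using y by (auto simp: C_def space_PiM PiE_def)
      qed
      then show "indicator E (merge A B (x, y)) \<le> (indicator C y :: ennreal)"
        by (auto simp: indicator_def)
    qed
    also have "\<dots> = emeasure (PiM B (\<lambda>_. P)) C" using C by simp
    also have "\<dots> = (\<Prod>b\<in>B. emeasure P (space P - Pair x -` Q))"
      unfolding C_def using fin Qx by (intro PP.emeasure_PiM) auto
    also have "\<dots> = ennreal ((1 - measure P (Pair x -` Q)) ^ card B)"
      using Qx by (simp add: P.emeasure_eq_measure P.prob_compl ennreal_power)
    also have "\<dots> \<le> ennreal ((1 - e) ^ card B)"
      using True by (intro ennreal_leI power_mono) auto
    finally show ?thesis .
  qed
  have "emeasure (PiM (A \<union> B) (\<lambda>_. P)) E = (\<integral>\<^sup>+ w. indicator E w \<partial>PiM (A \<union> B) (\<lambda>_. P))"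
    using E by simp
  also have "\<dots> = (\<integral>\<^sup>+ x. (\<integral>\<^sup>+ y. indicator E (merge A B (x, y)) \<partial>PiM B (\<lambda>_. P)) \<partial>PiM A (\<lambda>_. P))"
    using E by (intro PP.product_nn_integral_fold disj fin) simp
  also have "\<dots> \<le> (\<integral>\<^sup>+ x. ennreal ((1 - e) ^ card B) \<partial>PiM A (\<lambda>_. P))"
    by (intro nn_integral_mono inner)
  also have "\<dots> = ennreal ((1 - e) ^ card B)" by (simp add: A.emeasure_space_1)
  finally show "measure (PiM (A \<union> B) (\<lambda>_. P)) E \<le> (1 - e) ^ card B"
    using e by (simp add: AB.emeasure_eq_measure)
qed

section \<open>Measurability of the instability probability in the samples\<close>

text \<open>Projecting along the unbounded allocation space need not preserve closedness, so the
  fibre is exhausted by compact sets.\<close>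

lemma core_payoff_below_borel:
  fixes c :: real and S :: "'n::finite set"
  shows "{q :: (real ^ ('n set)) \<times> real. \<exists>x :: real ^ 'n. (\<Sum>i\<in>UNIV. x $ i) = c \<and>
      (\<forall>R. proper_coalition R \<longrightarrow> fst q $ R \<le> (\<Sum>i\<in>R. x $ i)) \<and> (\<Sum>i\<in>S. x $ i) < snd q} \<in> sets borel"
    (is "?H \<in> _")
proof -
  \<comment> \<open>The strict inequality is not a closed condition, so it is replaced by one with
    slack \<open>1 / (n + 1)\<close>; the ball bounds allocation and parameters together. Each
    \<open>F n\<close> is then compact, and so is its projection.\<close>
  define F where "F n = cball 0 (real n) \<inter> {p :: ((real ^ ('n set)) \<times> real) \<times> (real ^ 'n).
      (\<Sum>i\<in>UNIV. snd p $ i) = c \<and>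
      (\<forall>R. proper_coalition R \<longrightarrow> fst (fst p) $ R \<le> (\<Sum>i\<in>R. snd p $ i)) \<and>
      (\<Sum>i\<in>S. snd p $ i) + inverse (real (Suc n)) \<le> snd (fst p)}" for n
  have "closed {p :: ((real ^ ('n set)) \<times> real) \<times> (real ^ 'n).
      (\<Sum>i\<in>UNIV. snd p $ i) = c \<and>
      (\<forall>R. proper_coalition R \<longrightarrow> fst (fst p) $ R \<le> (\<Sum>i\<in>R. snd p $ i)) \<and>
      (\<Sum>i\<in>S. snd p $ i) + inverse (real (Suc n)) \<le> snd (fst p)}" for n
    by (intro closed_Collect_conj closed_Collect_eq closed_Collect_all closed_Collect_imp
        closed_Collect_le open_Collect_const continuous_intros)
  then have "compact (F n)" for n
    unfolding F_def by (intro compact_Int_closed) auto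
  then have cl: "closed (fst ` F n)" for n
    by (intro compact_imp_closed compact_continuous_image continuous_intros)
  have "?H = (\<Union>n. fst ` F n)"
  proof (intro set_eqI iffI)
    fix q assume "q \<in> ?H"
    then obtain x :: "real ^ 'n" where x: "(\<Sum>i\<in>UNIV. x $ i) = c"
      "\<forall>R. proper_coalition R \<longrightarrow> fst q $ R \<le> (\<Sum>i\<in>R. x $ i)" "(\<Sum>i\<in>S. x $ i) < snd q"
      by auto
    obtain n1 where n1: "inverse (real (Suc n1)) < snd q - (\<Sum>i\<in>S. x $ i)"
      using reals_Archimedean x(3) by (metis diff_gt_0_iff_gt)
    obtain n2 where n2: "norm (q, x) \<le> real n2" using real_arch_simple by blast
    \<comment> \<open>A larger index only enlarges the ball and shrinks the slack, so the maximum
      meets both requirements.\<close>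
    define n where "n = max n1 n2"
    have "inverse (real (Suc n)) \<le> inverse (real (Suc n1))"
      by (intro le_imp_inverse_le) (auto simp: n_def)
    with n1 have "(\<Sum>i\<in>S. x $ i) + inverse (real (Suc n)) \<le> snd q" by linarith
    moreover have "norm (q, x) \<le> real n" using n2 by (auto simp: n_def)
    ultimately have "(q, x) \<in> F n" using x by (simp add: F_def)
    then show "q \<in> (\<Union>n. fst ` F n)" by force
  next
    fix q assume "q \<in> (\<Union>n. fst ` F n)"
    then obtain n x where *: "(q, x) \<in> F n" by auto
    have "0 < inverse (real (Suc n))" by simp
    moreover have "(\<Sum>i\<in>S. x $ i) + inverse (real (Suc n)) \<le> snd q"
      using * by (simp add: F_def)
    ultimately have "(\<Sum>i\<in>S. x $ i) < snd q" by linarith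
    with * show "q \<in> ?H" unfolding F_def by (intro CollectI exI[of _ x]) simp
  qed
  with cl show ?thesis by (auto intro!: sets.countable_UN)
qed

text \<open>The samples enter the core only through the vector of coalition bounds. Hence the
  unstable pairs of sample and scenario form a finite union of preimages of Borel sets, and the
  measure of a slice depends measurably on the sample. This is what later allows passing from the
  stable event to its complement.\<close>

lemma borel_measurable_core_instability:
  fixes P :: "'a measure" and u :: "'n::finite set \<Rightarrow> 'a \<Rightarrow> real"
  assumes P: "prob_space P"
    and u: "\<And>S. proper_coalition S \<Longrightarrow> u S \<in> borel_measurable P"
  shows "(\<lambda>\<xi>. core_instability P u (scenario_core u c K \<xi>)) \<in> borel_measurable (sample_measure P K)"
proof -
  interpret P: prob_space P by fact
  let ?M = "sample_measure P K"
  \<comment> \<open>The value \<open>0\<close> at the empty and the grand coalition is a filler: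
    \<open>H\<close> reads only the entries of proper coalitions.\<close>
  define t where "t \<xi> = (\<chi> R. if proper_coalition R
      then MAX i\<in>R. MAX k\<in>{1..K i}. u R (\<xi> (i, k)) else 0)" for \<xi> :: "'n \<times> nat \<Rightarrow> 'a"
  have "(\<lambda>\<xi>. t \<xi> $ R) \<in> borel_measurable ?M" for R
  proof (cases "proper_coalition R")
    case True
    have "(\<lambda>\<xi>. u R (\<xi> (i, k))) \<in> borel_measurable ?M" if "k \<in> {1..K i}" for i k
      using that unfolding sample_measure_def
      by (intro measurable_compose[OF _ u[OF True]] measurable_component_singleton) auto
    then show ?thesis using True by (auto simp: t_def intro!: borel_measurable_Max)
  qed (simp add: t_def)
  then have t: "t \<in> borel_measurable ?M"
    unfolding borel_measurable_euclidean_space[of t]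
    by (auto simp: Basis_vec_def inner_axis)
  define H where "H S = {q :: (real ^ ('n set)) \<times> real. \<exists>x :: real ^ 'n. (\<Sum>i\<in>UNIV. x $ i) = c \<and>
      (\<forall>R. proper_coalition R \<longrightarrow> fst q $ R \<le> (\<Sum>i\<in>R. x $ i)) \<and> (\<Sum>i\<in>S. x $ i) < snd q}" for S :: "'n set"
  have H: "H S \<in> sets borel" for S
    unfolding H_def by (rule core_payoff_below_borel)
  define Q where "Q = (\<Union>S\<in>{S. proper_coalition S}.
      {p \<in> space (?M \<Otimes>\<^sub>M P). (t (fst p), u S (snd p)) \<in> H S})"
  have Q: "Q \<in> sets (?M \<Otimes>\<^sub>M P)"
    unfolding Q_def
  proof (intro sets.finite_UN)
    fix S :: "'n set" assume "S \<in> {S. proper_coalition S}"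
    then have "(\<lambda>p. (t (fst p), u S (snd p))) \<in> borel_measurable (?M \<Otimes>\<^sub>M P)"
      using t u by (intro borel_measurable_Pair measurable_compose[OF measurable_fst]
          measurable_compose[OF measurable_snd]) auto
    from measurable_sets[OF this H[of S]]
    show "{p \<in> space (?M \<Otimes>\<^sub>M P). (t (fst p), u S (snd p)) \<in> H S} \<in> sets (?M \<Otimes>\<^sub>M P)"
      by (simp add: vimage_def Int_def conj_commute)
  qed simp
  have "(\<lambda>\<xi>. measure P (Pair \<xi> -` Q)) \<in> borel_measurable ?M"
    unfolding measure_def using P.measurable_emeasure_Pair[OF Q] by simp
  moreover have "measure P (Pair \<xi> -` Q) = core_instability P u (scenario_core u c K \<xi>)"
    if "\<xi> \<in> space ?M" for \<xi>
  proof -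
    have "(t \<xi>, r) \<in> H S \<longleftrightarrow> (\<exists>x\<in>scenario_core u c K \<xi>. (\<Sum>i\<in>S. x $ i) < r)" for S r
      by (simp add: H_def t_def scenario_core_def Bex_def conj_assoc)
    then have "Pair \<xi> -` Q = {\<zeta> \<in> space P. \<exists>x\<in>scenario_core u c K \<xi>.
        \<exists>S. proper_coalition S \<and> (\<Sum>i\<in>S. x $ i) < u S \<zeta>}"
      using that unfolding Q_def by (simp add: space_pair_measure vimage_def) blast
    then show ?thesis by (simp add: core_instability_def)
  qed
  ultimately show ?thesis by (simp cong: measurable_cong)
qed

section \<open>Discarding samples of a single agent\<close>

text \<open>Samples of agent \<open>i\<close> do not bound coalitions without \<open>i\<close>, so a discarded sample may
  exceed the bound of such a coalition; hence the restriction \<open>i \<in> S\<close>.\<close>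

definition exceeds :: "('n set \<Rightarrow> 'a \<Rightarrow> real) \<Rightarrow> 'n \<Rightarrow> ('n \<times> nat) set \<Rightarrow> ('n \<times> nat \<Rightarrow> 'a) \<Rightarrow> 'a \<Rightarrow> bool"
  where "exceeds u i J \<xi> \<zeta> \<longleftrightarrow>
    (\<exists>S. proper_coalition S \<and> i \<in> S \<and> (\<forall>p\<in>J. fst p \<in> S \<longrightarrow> u S (\<xi> p) < u S \<zeta>))"

abbreviation sample_indices :: "('n::finite \<Rightarrow> nat) \<Rightarrow> ('n \<times> nat) set"
  where "sample_indices K \<equiv> SIGMA i:UNIV. {1..K i}"

definition discarded :: "('n \<Rightarrow> nat) \<Rightarrow> 'n \<Rightarrow> nat set \<Rightarrow> ('n \<times> nat) set"
  where "discarded K i I = {i} \<times> ({1..K i} - I)"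

text \<open>Agent \<open>i\<close> keeps the samples with indices in \<open>I\<close> and the other
  agents keep all of theirs, so the discarded samples act as independent tests. The event says that
  every test misses a set whose probability is above \<open>e\<close>.\<close>

definition bad_event ::
  "'a measure \<Rightarrow> ('n::finite set \<Rightarrow> 'a \<Rightarrow> real) \<Rightarrow> ('n \<Rightarrow> nat) \<Rightarrow> 'n \<Rightarrow> nat set \<Rightarrow> real \<Rightarrow> ('n \<times> nat \<Rightarrow> 'a) set"
  where "bad_event P u K i I e = {\<xi> \<in> space (sample_measure P K).
    (\<forall>b\<in>discarded K i I. \<not> exceeds u i (sample_indices K - discarded K i I) \<xi> (\<xi> b)) \<and>
    e < measure P {\<zeta> \<in> space P. exceeds u i (sample_indices K - discarded K i I) \<xi> \<zeta>}}"

text \<open>\<open>exceeds\<close> reads only the kept coordinates of the sample, so the set to be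
  avoided is a slice determined by them. Thus \<open>prob_avoid_le\<close> applies with the
  \<open>K i - card I\<close> discarded coordinates as \<open>B\<close>.\<close>

lemma bad_event_prob:
  fixes P :: "'a measure" and u :: "'n::finite set \<Rightarrow> 'a \<Rightarrow> real"
  assumes P: "prob_space P"
    and u: "\<And>S. proper_coalition S \<Longrightarrow> u S \<in> borel_measurable P"
    and I: "I \<subseteq> {1..K i}" and e: "e \<le> 1"
  shows "bad_event P u K i I e \<in> sets (sample_measure P K)"
    and "measure (sample_measure P K) (bad_event P u K i I e) \<le> (1 - e) ^ (K i - card I)"
proof -
  define B where "B = discarded K i I"
  define A where "A = sample_indices K - B"
  have fin: "finite A" "finite B" unfolding A_def B_def discarded_def by auto
  have disj: "A \<inter> B = {}" unfolding A_def by auto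
  have AB: "A \<union> B = sample_indices K" unfolding A_def B_def discarded_def by auto
  have card: "card B = K i - card I"
    using I by (simp add: B_def discarded_def card_cartesian_product card_Diff_subset finite_subset)
  let ?N = "PiM A (\<lambda>_. P) \<Otimes>\<^sub>M P"
  define Q where "Q = {q \<in> space ?N. exceeds u i A (fst q) (snd q)}"
  have Q: "Q \<in> sets ?N"
  proof -
    have "Measurable.pred ?N (\<lambda>q. u S (fst q p) < u S (snd q))"
      if "proper_coalition S" "p \<in> A" for S p
    proof -
      note [measurable] = u[OF that(1)]
      show ?thesis using that(2) by measurable
    qed
    then have "Measurable.pred ?N (\<lambda>q. \<exists>S\<in>{S. proper_coalition S \<and> i \<in> S}.
        \<forall>p\<in>{p \<in> A. fst p \<in> S}. u S (fst q p) < u S (snd q))"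
      using fin by (intro pred_intros_finite) auto
    then show ?thesis
      unfolding Q_def exceeds_def by (simp add: pred_def Bex_def Ball_def conj_assoc imp_conjL)
  qed
  have ex_restrict: "exceeds u i A (restrict \<xi> A) \<zeta> \<longleftrightarrow> exceeds u i A \<xi> \<zeta>" for \<xi> \<zeta>
    by (auto simp: exceeds_def)
  have "bad_event P u K i I e = {\<omega> \<in> space (PiM (A \<union> B) (\<lambda>_. P)).
      (\<forall>b\<in>B. (restrict \<omega> A, \<omega> b) \<notin> Q) \<and> e < measure P (Pair (restrict \<omega> A) -` Q)}"
  proof -
    have "(\<forall>b\<in>B. (restrict \<omega> A, \<omega> b) \<notin> Q) = (\<forall>b\<in>B. \<not> exceeds u i A \<omega> (\<omega> b))"
      and "Pair (restrict \<omega> A) -` Q = {\<zeta> \<in> space P. exceeds u i A \<omega> \<zeta>}"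
      if "\<omega> \<in> space (PiM (A \<union> B) (\<lambda>_. P))" for \<omega>
      using that by (auto simp: Q_def space_pair_measure ex_restrict space_PiM PiE_def Pi_def)
    then show ?thesis
      unfolding bad_event_def sample_measure_def AB[symmetric] B_def[symmetric]
      using disj by (auto simp: Un_Diff Diff_triv)
  qed
  with prob_avoid_le[OF P fin disj Q e]
  show "bad_event P u K i I e \<in> sets (sample_measure P K)"
    and "measure (sample_measure P K) (bad_event P u K i I e) \<le> (1 - e) ^ (K i - card I)"
    by (simp_all add: sample_measure_def AB card)
qed

section \<open>Counting kept subsets and supporting samples\<close>

text \<open>Grouping by size turns a union bound over kept index sets into the binomial sum
  prescribed for \<open>\<epsilon>\<close>. The full set is left out, matching the range
  \<open>k < K i\<close>: with nothing discarded the bound is trivial.\<close>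

lemma sum_subsets_card_less:
  fixes g :: "nat \<Rightarrow> real"
  assumes "finite A"
  shows "(\<Sum>I | I \<subset> A. g (card I)) = (\<Sum>k<card A. real (card A choose k) * g k)"
proof -
  have "(\<Sum>I | I \<subset> A. g (card I)) = (\<Sum>k<card A. \<Sum>I | I \<in> {I. I \<subset> A} \<and> card I = k. g (card I))"
    using assms finite_subset[of "{I. I \<subset> A}" "Pow A"]
    by (intro sum.group[symmetric]) (auto intro: psubset_card_mono)
  also have "\<dots> = (\<Sum>k<card A. real (card A choose k) * g k)"
  proof (rule sum.cong)
    fix k assume "k \<in> {..<card A}"
    then have "{I. I \<in> {I. I \<subset> A} \<and> card I = k} = {I. I \<subseteq> A \<and> card I = k}" by auto
    then show "(\<Sum>I | I \<in> {I. I \<subset> A} \<and> card I = k. g (card I)) = real (card A choose k) * g k"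
      using n_subsets[OF assms, of k] by simp
  qed simp
  finally show ?thesis .
qed

text \<open>For each proper coalition, one maximiser over the pooled samples of its members
  dominates all of them. Coalitions may share a maximiser, so the number of proper coalitions bounds
  the size of the support.\<close>

lemma support_exists:
  fixes u :: "'n::finite set \<Rightarrow> 'a \<Rightarrow> real"
  assumes K: "\<And>i. 0 < K i"
  obtains T where "T \<subseteq> sample_indices K" "card T \<le> 2 ^ CARD('n) - 1"
    "\<And>S i k. proper_coalition S \<Longrightarrow> i \<in> S \<Longrightarrow> k \<in> {1..K i} \<Longrightarrow>
      \<exists>p\<in>T. fst p \<in> S \<and> u S (\<xi> (i, k)) \<le> u S (\<xi> p)"
proof -
  have "\<exists>p\<in>(SIGMA i:S. {1..K i}). \<forall>q\<in>(SIGMA i:S. {1..K i}). u S (\<xi> q) \<le> u S (\<xi> p)"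
    if S: "proper_coalition S" for S
  proof -
    let ?X = "SIGMA i:S. {1..K i}"
    obtain i where "i \<in> S" using S by (auto simp: proper_coalition_def)
    then have "(i, 1) \<in> ?X" using K[of i] by auto
    then have ne: "?X \<noteq> {}" by blast
    have fin: "finite ?X" by auto
    have "Max ((\<lambda>p. u S (\<xi> p)) ` ?X) \<in> (\<lambda>p. u S (\<xi> p)) ` ?X"
      using fin ne by (intro Max_in) auto
    then obtain p where "p \<in> ?X" "Max ((\<lambda>p. u S (\<xi> p)) ` ?X) = u S (\<xi> p)" by blast
    moreover have "u S (\<xi> q) \<le> Max ((\<lambda>p. u S (\<xi> p)) ` ?X)" if "q \<in> ?X" for q
      using fin that by (intro Max_ge) auto
    ultimately show ?thesis by metis
  qed
  then obtain a where a: "\<And>S. proper_coalition S \<Longrightarrow> a S \<in> (SIGMA i:S. {1..K i})"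
    "\<And>S q. proper_coalition S \<Longrightarrow> q \<in> (SIGMA i:S. {1..K i}) \<Longrightarrow> u S (\<xi> q) \<le> u S (\<xi> (a S))"
    by metis
  let ?C = "{S :: 'n set. proper_coalition S}"
  \<comment> \<open>Removing only the empty set leaves the grand coalition counted, hence
    \<open>2 ^ N - 1\<close> although there are \<open>2 ^ N - 2\<close> proper coalitions.\<close>
  have "card ?C \<le> card (UNIV - {{}} :: 'n set set)"
    by (intro card_mono) (auto simp: proper_coalition_def)
  also have "\<dots> = 2 ^ CARD('n) - 1"
    by (simp add: card_Diff_singleton card_UNIV_set)
  finally have "card (a ` ?C) \<le> 2 ^ CARD('n) - 1"
    using card_image_le[of ?C a] by simp
  moreover have "a ` ?C \<subseteq> sample_indices K" using a(1) by fastforce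
  moreover have "\<exists>p\<in>a ` ?C. fst p \<in> S \<and> u S (\<xi> (i, k)) \<le> u S (\<xi> p)"
    if "proper_coalition S" "i \<in> S" "k \<in> {1..K i}" for S i k
    using a(1)[OF that(1)] a(2)[OF that(1), of "(i, k)"] that by (intro bexI[of _ "a S"]) auto
  ultimately show thesis using that by blast
qed

section \<open>Deterministic bound outside the bad events\<close>

lemma eps_star_ge:
  fixes K s :: "'n::finite \<Rightarrow> nat"
  assumes "(\<Sum>i\<in>UNIV. s i) \<le> M" "\<And>i. s i \<le> K i"
  shows "(\<Sum>i\<in>UNIV. \<epsilon> i (s i)) \<le> eps_star K M \<epsilon>"
  unfolding eps_star_def
proof (rule Max_ge)
  have "finite (PiE UNIV (\<lambda>i. {0..K i}))" by (intro finite_PiE) auto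
  then show "finite {\<Sum>i\<in>UNIV. \<epsilon> i (s i) | s. (\<Sum>i\<in>UNIV. s i) \<le> M \<and> (\<forall>i. s i \<in> {0..K i})}"
    by (rule finite_surj[where f = "\<lambda>s. \<Sum>i\<in>UNIV. \<epsilon> i (s i)"]) auto
  show "(\<Sum>i\<in>UNIV. \<epsilon> i (s i)) \<in> {\<Sum>i\<in>UNIV. \<epsilon> i (s i) | s. (\<Sum>i\<in>UNIV. s i) \<le> M \<and> (\<forall>i. s i \<in> {0..K i})}"
    using assms by auto
qed

text \<open>The sample is fixed here. Its support decides which samples each agent keeps; as this
  choice depends on the data, \<open>good\<close> has to cover all proper index sets. The sizes of
  the kept sets form an admissible argument in \<open>eps_star\<close>.\<close>

lemma core_instability_le:
  fixes P :: "'a measure" and u :: "'n::finite set \<Rightarrow> 'a \<Rightarrow> real"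
  assumes P: "prob_space P"
    and u: "\<And>S. proper_coalition S \<Longrightarrow> u S \<in> borel_measurable P"
    and K: "\<And>i. 0 < K i"
    and \<epsilon>: "\<And>i. \<epsilon> i (K i) = 1"
    and \<xi>: "\<xi> \<in> space (sample_measure P K)"
    and good: "\<And>i I. I \<subset> {1..K i} \<Longrightarrow> \<xi> \<notin> bad_event P u K i I (\<epsilon> i (card I))"
  shows "core_instability P u (scenario_core u c K \<xi>) \<le> eps_star K (2 ^ CARD('n) - 1) \<epsilon>"
proof -
  interpret P: prob_space P by fact
  obtain T where T: "T \<subseteq> sample_indices K" "card T \<le> 2 ^ CARD('n) - 1"
    "\<And>S i k. proper_coalition S \<Longrightarrow> i \<in> S \<Longrightarrow> k \<in> {1..K i} \<Longrightarrow>
      \<exists>p\<in>T. fst p \<in> S \<and> u S (\<xi> (i, k)) \<le> u S (\<xi> p)"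
    using support_exists[where u = u and K = K and \<xi> = \<xi>] K by blast
  define I where "I i = {k. (i, k) \<in> T}" for i
  have I: "I i \<subseteq> {1..K i}" for i using T(1) by (auto simp: I_def)
  have finI: "finite (I i)" for i using I finite_subset by blast
  have "T = (SIGMA i:UNIV. I i)" by (auto simp: I_def)
  then have sumI: "(\<Sum>i\<in>UNIV. card (I i)) \<le> 2 ^ CARD('n) - 1"
    using T(2) finI by (simp add: card_SigmaI)
  have cardI: "card (I i) \<le> K i" for i using card_mono[OF _ I[of i]] by simp
  \<comment> \<open>Besides the support, all samples of the other agents stay in \<open>J i\<close>,
    so it depends on the sample through \<open>I i\<close> alone, as \<open>bad_event\<close>
    requires.\<close>
  define J where "J i = sample_indices K - discarded K i (I i)" for i
  define W where "W i = {\<zeta> \<in> space P. exceeds u i (J i) \<xi> \<zeta>}" for i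
  have TJ: "T \<subseteq> J i" for i using T(1) by (auto simp: J_def discarded_def I_def)
  have W: "W i \<in> sets P" for i
  proof -
    have "Measurable.pred P (\<lambda>\<zeta>. u S (\<xi> p) < u S \<zeta>)" if "proper_coalition S" for S p
    proof -
      note [measurable] = u[OF that]
      show ?thesis by measurable
    qed
    then have "Measurable.pred P (\<lambda>\<zeta>. \<exists>S\<in>{S. proper_coalition S \<and> i \<in> S}.
        \<forall>p\<in>{p \<in> J i. fst p \<in> S}. u S (\<xi> p) < u S \<zeta>)"
      by (intro pred_intros_finite) (auto simp: J_def)
    then show ?thesis
      unfolding W_def exceeds_def by (simp add: pred_def Bex_def Ball_def conj_assoc imp_conjL)
  qed
  have Wle: "measure P (W i) \<le> \<epsilon> i (card (I i))" for i
  proof (cases "I i = {1..K i}")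
    \<comment> \<open>All samples of \<open>i\<close> are kept, and
      \<open>\<epsilon> i (K i) = 1\<close> bounds any probability.\<close>
    case True
    then show ?thesis using \<epsilon>[of i] by simp
  next
    case False
    \<comment> \<open>A discarded sample of \<open>i\<close> is dominated, for every
      \<open>S\<close> containing \<open>i\<close>, by a support element of a member of
      \<open>S\<close>. That element lies in \<open>J i\<close>, which contradicts the strict
      inequality in \<open>exceeds\<close>.\<close>
    have "\<not> exceeds u i (J i) \<xi> (\<xi> b)" if b_disc: "b \<in> discarded K i (I i)" for b
    proof
      assume "exceeds u i (J i) \<xi> (\<xi> b)"
      then obtain S where S: "proper_coalition S" "i \<in> S"
        "\<And>p. p \<in> J i \<Longrightarrow> fst p \<in> S \<Longrightarrow> u S (\<xi> p) < u S (\<xi> b)"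
        by (auto simp: exceeds_def)
      obtain k where b: "b = (i, k)" "k \<in> {1..K i}" using b_disc by (auto simp: discarded_def)
      obtain p where "p \<in> T" "fst p \<in> S" "u S (\<xi> b) \<le> u S (\<xi> p)"
        using T(3)[OF S(1,2) b(2)] b(1) by blast
      then show False using S(3)[of p] TJ by fastforce
    qed
    moreover have "I i \<subset> {1..K i}" using False I[of i] by blast
    ultimately show ?thesis using good[of "I i" i] \<xi>
      by (auto simp: bad_event_def J_def W_def)
  qed
  have "{\<zeta> \<in> space P. \<exists>x\<in>scenario_core u c K \<xi>. \<exists>S. proper_coalition S \<and> (\<Sum>i\<in>S. x $ i) < u S \<zeta>}
      \<subseteq> (\<Union>i. W i)"
  proof
    fix \<zeta> assume "\<zeta> \<in> {\<zeta> \<in> space P. \<exists>x\<in>scenario_core u c K \<xi>.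
        \<exists>S. proper_coalition S \<and> (\<Sum>i\<in>S. x $ i) < u S \<zeta>}"
    then obtain x S where *: "\<zeta> \<in> space P" "x \<in> scenario_core u c K \<xi>" "proper_coalition S"
      "(\<Sum>i\<in>S. x $ i) < u S \<zeta>" by blast
    \<comment> \<open>Any member of the violated coalition can take the charge, because the scenario
      strictly exceeds the samples of all members.\<close>
    obtain i where i: "i \<in> S" using *(3) by (auto simp: proper_coalition_def)
    have "u S (\<xi> (j, k)) < u S \<zeta>" if "j \<in> S" "k \<in> {1..K j}" for j k
    proof -
      have "u S (\<xi> (j, k)) \<le> (MAX k\<in>{1..K j}. u S (\<xi> (j, k)))"
        using that by (intro Max_ge) auto
      also have "\<dots> \<le> (MAX j\<in>S. MAX k\<in>{1..K j}. u S (\<xi> (j, k)))"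
        using that by (intro Max_ge) auto
      also have "\<dots> \<le> (\<Sum>i\<in>S. x $ i)" using *(2,3) by (auto simp: scenario_core_def)
      finally show ?thesis using *(4) by simp
    qed
    then have "exceeds u i (J i) \<xi> \<zeta>"
      unfolding exceeds_def using *(3) i by (intro exI[of _ S]) (auto simp: J_def)
    then show "\<zeta> \<in> (\<Union>i. W i)" using *(1) by (auto simp: W_def)
  qed
  then have "core_instability P u (scenario_core u c K \<xi>) \<le> measure P (\<Union>i. W i)"
    unfolding core_instability_def using W by (intro P.finite_measure_mono) auto
  also have "\<dots> \<le> (\<Sum>i\<in>UNIV. measure P (W i))"
    using W by (intro P.finite_measure_subadditive_finite) auto
  also have "\<dots> \<le> (\<Sum>i\<in>UNIV. \<epsilon> i (card (I i)))" by (intro sum_mono Wle)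
  also have "\<dots> \<le> eps_star K (2 ^ CARD('n) - 1) \<epsilon>" by (rule eps_star_ge[OF sumI cardI])
  finally show ?thesis .
qed

section \<open>Union bound over agents and kept subsets\<close>

theorem theorem2:
  fixes P :: "'a measure"
    and u :: "'n::finite set \<Rightarrow> 'a \<Rightarrow> real"
    and uN :: real
    and K :: "'n \<Rightarrow> nat"
    and \<beta> :: real
    and \<beta>i :: "'n \<Rightarrow> real"
    and \<epsilon> :: "'n \<Rightarrow> nat \<Rightarrow> real"
  assumes "prob_space P"
    and "\<And>S. proper_coalition S \<Longrightarrow> u S \<in> borel_measurable P"
    and "\<And>\<xi>. \<xi> \<in> space (sample_measure P K) \<Longrightarrow> scenario_core u uN K \<xi> \<noteq> {}"
    and "0 < \<beta>" and "\<beta> < 1"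
    and "\<And>i. 0 < \<beta>i i" and "\<And>i. \<beta>i i < 1"
    and "(\<Sum>i\<in>UNIV. \<beta>i i) = \<beta>"
    and "\<And>i k. k \<le> K i \<Longrightarrow> 0 \<le> \<epsilon> i k \<and> \<epsilon> i k \<le> 1"
    and "\<And>i. \<epsilon> i (K i) = 1"
    and "\<And>i. (\<Sum>k<K i. real (K i choose k) * (1 - \<epsilon> i k) ^ (K i - k)) = \<beta>i i"
  shows "measure (sample_measure P K)
      {\<xi> \<in> space (sample_measure P K).
         core_instability P u (scenario_core u uN K \<xi>)
           \<le> eps_star K (2 ^ CARD('n) - 1) \<epsilon>} \<ge> 1 - \<beta>"
proof -
  note P = assms(1) and u = assms(2)
  \<comment> \<open>For \<open>K i = 0\<close> the binomial sum is empty, which would force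
    \<open>\<beta>i i = 0\<close>.\<close>
  have K: "0 < K i" for i
    using assms(6)[of i] assms(11)[of i] by (cases "K i") auto
  let ?M = "sample_measure P K"
  interpret M: prob_space ?M
    unfolding sample_measure_def by (rule prob_space_PiM) (rule P)
  define G where "G = {\<xi> \<in> space ?M. core_instability P u (scenario_core u uN K \<xi>)
      \<le> eps_star K (2 ^ CARD('n) - 1) \<epsilon>}"
  define E where "E i I = bad_event P u K i I (\<epsilon> i (card I))" for i I
  have G: "G \<in> sets ?M"
  proof -
    note [measurable] = borel_measurable_core_instability[OF P u, where c = uN and K = K]
    show ?thesis unfolding G_def by measurable
  qed
  have cardI: "card I \<le> K i" if "I \<subset> {1..K i}" for i I
    using card_mono[of "{1..K i}" I] that by auto
  have E: "E i I \<in> sets ?M" "measure ?M (E i I) \<le> (1 - \<epsilon> i (card I)) ^ (K i - card I)"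
    if "I \<subset> {1..K i}" for i I
    using bad_event_prob[OF P u, where I = I and i = i and K = K and e = "\<epsilon> i (card I)"] that assms(9)[OF cardI[OF that]]
    by (auto simp: E_def)
  let ?Ei = "\<lambda>i. \<Union>I\<in>{I. I \<subset> {1..K i}}. E i I"
  have fin: "finite {I. I \<subset> {1..K i}}" for i
    by (rule finite_subset[of _ "Pow {1..K i}"]) auto
  have Ei: "?Ei i \<in> sets ?M" for i using E(1) fin by (intro sets.finite_UN) auto
  have "measure ?M (?Ei i) \<le> \<beta>i i" for i
  proof -
    have "measure ?M (?Ei i) \<le> (\<Sum>I | I \<subset> {1..K i}. measure ?M (E i I))"
      using E(1) fin by (intro M.finite_measure_subadditive_finite) auto
    also have "\<dots> \<le> (\<Sum>I | I \<subset> {1..K i}. (1 - \<epsilon> i (card I)) ^ (K i - card I))"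
      using E(2) by (intro sum_mono) auto
    also have "\<dots> = \<beta>i i"
      using sum_subsets_card_less[of "{1..K i}" "\<lambda>k. (1 - \<epsilon> i k) ^ (K i - k)"] assms(11)[of i]
      by simp
    finally show ?thesis .
  qed
  then have "(\<Sum>i\<in>UNIV. measure ?M (?Ei i)) \<le> \<beta>"
    using assms(8) by (metis (no_types, lifting) sum_mono)
  moreover have "measure ?M (\<Union>i. ?Ei i) \<le> (\<Sum>i\<in>UNIV. measure ?M (?Ei i))"
    using Ei by (intro M.finite_measure_subadditive_finite) auto
  \<comment> \<open>By contraposition of \<open>core_instability_le\<close>, a sample with too large
    an instability lies in some bad event.\<close>
  moreover have "space ?M - G \<subseteq> (\<Union>i. ?Ei i)"
  proof
    fix \<xi> assume "\<xi> \<in> space ?M - G"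
    then show "\<xi> \<in> (\<Union>i. ?Ei i)"
      using core_instability_le[of P u K \<epsilon> \<xi> uN, OF P u K assms(10)]
      by (auto simp: G_def E_def)
  qed
  then have "measure ?M (space ?M - G) \<le> measure ?M (\<Union>i. ?Ei i)"
    using Ei by (intro M.finite_measure_mono) auto
  ultimately have "1 - measure ?M G \<le> \<beta>" using M.prob_compl[OF G] by linarith
  then show ?thesis by (simp add: G_def)
qed

end
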